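(* Let $b$ be a fixed non-zero integer, let $r\geq 1$ and let $A_1,\dots,A_r$ be fixed positive integers, and let $d$ be a positive integer. Consider the equation $$b\, n_1!A_1^{n_1}\, n_2!A_2^{n_2}\cdots n_r!A_r^{n_r}=x^d$$ in unknowns $(n_1,\dots,n_r,x)$, where $n_1,\dots,n_r$ are non-negative integers and $x$ is an integer. (i) If $d>r$, then this equation has only finitely many integer solutions. (ii) If $d\leq r$, then this equation has infinitely many integer solutions, except when $b<0$ and $d$ is even, in which case it has no solutions. *)

theory Defs
  imports Complex_Main "HOL-Library.FuncSet"
begin

text \<open>The unknowns \<open>(n\<^sub>1, \<dots>, n\<^sub>r)\<close> form an extensional function on \<open>{1..r}\<close>, with a fixed
  dummy value outside, so that distinct elements of this set are distinct solutions.\<close>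

definition solutions :: "int \<Rightarrow> nat \<Rightarrow> (nat \<Rightarrow> int) \<Rightarrow> nat \<Rightarrow> ((nat \<Rightarrow> nat) \<times> int) set" where
  "solutions b r A d =
     {(n, x). n \<in> {1..r} \<rightarrow>\<^sub>E UNIV \<and> b * (\<Prod>i=1..r. fact (n i) * A i ^ n i) = x ^ d}"

end

theory Submission
  imports Defs "HOL-Computational_Algebra.Primes" "HOL-Real_Asymp.Real_Asymp"
begin

text \<open>
  If \<open>d > r\<close> and \<open>N\<close> is the largest of the \<open>n\<^sub>i\<close>, Bertrand's postulate gives, for large \<open>N\<close>, a prime
  \<open>p\<close> with \<open>N/2 < p \<le> N\<close> that divides none of \<open>b, A\<^sub>1, \<dots>, A\<^sub>r\<close>. It divides each \<open>n\<^sub>i!\<close> at most once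
  and some \<open>n\<^sub>i!\<close> exactly once, so its exponent on the left-hand side lies between \<open>1\<close> and
  \<open>r < d\<close> and is not a multiple of \<open>d\<close>. Bertrand's postulate is needed for large \<open>N\<close> only and is
  obtained from Erdos's analysis of the prime factors of \<open>2n choose n\<close>.

  If \<open>d \<le> r\<close>, take \<open>n\<^sub>1 = N\<close>, \<open>n\<^sub>2 = \<dots> = n\<^sub>d = N - 1\<close> and all other \<open>n\<^sub>i = 0\<close>, with \<open>d\<close> dividing
  \<open>N\<close>. Up to \<open>d\<close>-th powers the left-hand side is \<open>b N C\<^sup>d\<^sup>-\<^sup>1\<close> with \<open>C = A\<^sub>2 \<dots> A\<^sub>d\<close>, which is a
  \<open>d\<close>-th power for \<open>N = C |b|\<^sup>d\<^sup>-\<^sup>1 (d k)\<^sup>d\<close>, \<open>k \<ge> 1\<close>.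
\<close>

section \<open>Legendre's formula and the prime factors of central binomial coefficients\<close>

lemma card_prime_power_divisors:
  fixes p n K :: nat
  assumes "prime p" "n > 0" "n < p ^ Suc K"
  shows "card {k \<in> {1..K}. p ^ k dvd n} = multiplicity p n"
proof -
  have iff: "p ^ k dvd n \<longleftrightarrow> k \<le> multiplicity p n" for k
    using assms by (intro power_dvd_iff_le_multiplicity) (auto simp: prime_gt_1_nat)
  have "multiplicity p n \<le> K"
  proof (rule ccontr)
    assume "\<not> multiplicity p n \<le> K"
    hence "p ^ Suc K dvd n" using iff[of "Suc K"] by (simp del: power_Suc)
    with assms show False by (auto dest: dvd_imp_le)
  qed
  hence "{k \<in> {1..K}. k \<le> multiplicity p n} = {1..multiplicity p n}" by auto
  thus ?thesis by (simp add: iff)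
qed

text \<open>Passing from \<open>n\<close> to \<open>Suc n\<close> raises \<open>n div p ^ k\<close>
  by one exactly when \<open>p ^ k\<close> divides \<open>Suc n\<close>. The sum may stop at any
  \<open>K\<close> with \<open>n < p ^ Suc K\<close>, since later terms vanish.\<close>

lemma multiplicity_fact_legendre:
  fixes p n K :: nat
  assumes "prime p" "n < p ^ Suc K"
  shows "multiplicity p (fact n) = (\<Sum>k=1..K. n div p ^ k)"
  using assms(2)
proof (induction n)
  case (Suc n)
  have "multiplicity p (fact (Suc n)) = multiplicity p (Suc n) + multiplicity p (fact n)"
    using assms(1) prime_elem_multiplicity_mult_distrib[of p "Suc n" "fact n"]
    by (simp only: fact_Suc of_nat_id prime_imp_prime_elem fact_nonzero nat.simps refl simp_thms)
  also have "multiplicity p (Suc n) = (\<Sum>k=1..K. if p ^ k dvd Suc n then 1 else 0)"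
    using card_prime_power_divisors[OF assms(1) _ Suc.prems]
    by (simp add: sum.If_cases Int_def)
  also have "multiplicity p (fact n) = (\<Sum>k=1..K. n div p ^ k)"
    using Suc by simp
  also have "(\<Sum>k=1..K. if p ^ k dvd Suc n then 1 else 0) + \<dots> = (\<Sum>k=1..K. Suc n div p ^ k)"
    by (subst sum.distrib [symmetric], intro sum.cong) (auto simp: div_Suc dvd_eq_mod_eq_0)
  finally show ?case .
qed auto

lemma multiplicity_central_binomial:
  fixes p n K :: nat
  assumes "prime p" "2 * n < p ^ Suc K"
  shows "multiplicity p (2 * n choose n) = (\<Sum>k=1..K. 2 * n div p ^ k - 2 * (n div p ^ k))"
proof -
  have "fact n * fact n * (2 * n choose n) = (fact (2 * n) :: nat)"
    using binomial_fact_lemma[of n "2 * n"] by simp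
  hence "multiplicity p (fact (2 * n)) = multiplicity p (fact n * fact n * (2 * n choose n))"
    by simp
  also have "\<dots> = 2 * multiplicity p (fact n) + multiplicity p (2 * n choose n)"
    using assms(1) by (simp add: prime_elem_multiplicity_mult_distrib)
  finally have "multiplicity p (2 * n choose n) = multiplicity p (fact (2 * n)) - 2 * multiplicity p (fact n)"
    by simp
  also have "\<dots> = (\<Sum>k=1..K. 2 * n div p ^ k) - (\<Sum>k=1..K. 2 * (n div p ^ k))"
    using assms by (simp add: multiplicity_fact_legendre[of p _ K] sum_distrib_left)
  also have "\<dots> = (\<Sum>k=1..K. 2 * n div p ^ k - 2 * (n div p ^ k))"
    by (rule sum_subtractf_nat [symmetric]) (metis div_mult1_eq le_add1)
  finally show ?thesis .
qed

text \<open>With \<open>p ^ K\<close> the largest power of \<open>p\<close> up to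
  \<open>2 * n\<close>, the multiplicity is a sum of \<open>K\<close> terms, each 0 or 1.\<close>

lemma prime_power_multiplicity_central_binomial_le:
  fixes p n :: nat
  assumes "prime p" "n > 0"
  shows "p ^ multiplicity p (2 * n choose n) \<le> 2 * n"
proof -
  obtain K where K: "p ^ K \<le> 2 * n" "2 * n < p ^ Suc K"
    using ex_power_ivl1[of p "2 * n"] assms prime_ge_2_nat by auto
  have "2 * n div q - 2 * (n div q) \<le> 1" if "q > 0" for q :: nat
  proof -
    have "2 * n < 2 * (q * (n div q) + q)"
      using that dividend_less_times_div[of q n] by simp
    also have "\<dots> = (2 * (n div q) + 2) * q" by (simp add: algebra_simps)
    finally have "2 * n div q < 2 * (n div q) + 2" by (rule less_mult_imp_div_less)
    thus ?thesis by simp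
  qed
  hence "multiplicity p (2 * n choose n) \<le> (\<Sum>k=1..K. 1)"
    unfolding multiplicity_central_binomial[OF assms(1) K(2)] using assms(1)
    by (intro sum_mono) (simp add: prime_gt_0_nat)
  hence "p ^ multiplicity p (2 * n choose n) \<le> p ^ K"
    using prime_gt_0_nat[OF assms(1)] by (intro power_increasing) auto
  with K(1) show ?thesis by simp
qed

text \<open>Only \<open>p\<close> and \<open>2 * p\<close> contribute a factor \<open>p\<close> to
  \<open>fact (2 * n)\<close>, and the two copies of \<open>fact n\<close> cancel both. The
  condition \<open>p \<ge> 3\<close> yields \<open>2 * n < p ^ 2\<close>, which excludes higher
  powers.\<close>

lemma multiplicity_central_binomial_eq_0:
  fixes p n :: nat
  assumes "prime p" "p \<ge> 3" "p \<le> n" "2 * n < 3 * p"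
  shows "multiplicity p (2 * n choose n) = 0"
proof -
  have "3 * p \<le> p * p" using assms by simp
  with assms(4) have "2 * n < p * p" by linarith
  hence "2 * n < p ^ Suc 1" by simp
  moreover have "n div p = 1" "2 * n div p = 2"
    using assms by (auto intro!: div_nat_eqI)
  ultimately show ?thesis
    using multiplicity_central_binomial[OF assms(1), of n 1] by simp
qed

section \<open>Chebyshev's bound on the product of the primes up to n\<close>

lemma prod_primes_dvd:
  fixes P :: "nat set"
  assumes "finite P" "\<And>p. p \<in> P \<Longrightarrow> prime p \<and> p dvd n"
  shows "\<Prod>P dvd n"
  using assms
proof (induction P rule: finite_induct)
  case (insert p P)
  have "coprime p (\<Prod>P)"
    using insert by (intro prod_coprime_right primes_coprime) auto
  with insert show ?case by (auto intro: divides_mult)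
qed auto

text \<open>These primes divide \<open>fact (2 * m + 1)\<close> but neither \<open>fact m\<close>
  nor \<open>fact (Suc m)\<close>, so their product divides the binomial coefficient. That
  coefficient occurs twice in a row of sum \<open>2 * 4 ^ m\<close>.\<close>

lemma prod_primes_odd_le:
  "\<Prod>{p :: nat. prime p \<and> m + 1 < p \<and> p \<le> 2 * m + 1} \<le> 4 ^ m"
proof -
  let ?c = "2 * m + 1 choose m"
  have fact: "fact m * fact (Suc m) * ?c = (fact (2 * m + 1) :: nat)"
    using binomial_fact_lemma[of m "2 * m + 1"] by (simp del: fact_Suc)
  have "p dvd ?c" if "prime p" "m + 1 < p" "p \<le> 2 * m + 1" for p
  proof -
    have "p dvd fact m * fact (Suc m) * ?c"
      unfolding fact using that by (subst prime_dvd_fact_iff) auto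
    thus ?thesis using that by (auto simp: prime_dvd_mult_iff prime_dvd_fact_iff simp del: fact_Suc)
  qed
  hence "\<Prod>{p. prime p \<and> m + 1 < p \<and> p \<le> 2 * m + 1} dvd ?c"
    by (intro prod_primes_dvd) auto
  hence "\<Prod>{p. prime p \<and> m + 1 < p \<and> p \<le> 2 * m + 1} \<le> ?c"
    by (rule dvd_imp_le) simp
  also have "2 * ?c = ?c + (2 * m + 1 choose Suc m)"
    using binomial_symmetric[of m "2 * m + 1"] by simp
  hence "2 * ?c = (\<Sum>k\<in>{m, Suc m}. 2 * m + 1 choose k)" by simp
  hence "2 * ?c \<le> 2 * 4 ^ m"
    using sum_mono2[of "{..2 * m + 1}" "{m, Suc m}" "\<lambda>k. 2 * m + 1 choose k"]
    by (simp add: choose_row_sum power_mult del: binomial_Suc_Suc sum.atMost_Suc) 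
  hence "?c \<le> 4 ^ m" by simp
  finally show ?thesis .
qed

text \<open>Strong induction: for odd \<open>n = 2 * m + 1\<close> the primes are split at
  \<open>m + 1\<close>; an even \<open>n > 2\<close> is not prime, so the bound for
  \<open>n - 1\<close> suffices.\<close>

lemma primorial_le: "\<Prod>{p :: nat. prime p \<and> p \<le> n} \<le> 4 ^ n"
proof (induction n rule: less_induct)
  case (less n)
  consider "n \<le> 2" | m where "n = 2 * m + 1" "m > 0" | m where "n = 2 * m" "m > 1"
    by (cases "even n"; cases "n \<le> 2") (auto elim!: evenE oddE)
  then show ?case
  proof cases
    case 1
    have "{p :: nat. prime p \<and> p \<le> n} = (if n = 2 then {2} else {})"
      using 1 by (auto dest: prime_ge_2_nat)
    thus ?thesis by simp
  next
    case (2 m)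
    have "{p. prime p \<and> p \<le> n} =
        {p. prime p \<and> p \<le> m + 1} \<union> {p. prime p \<and> m + 1 < p \<and> p \<le> 2 * m + 1}"
      using 2 by auto
    hence "\<Prod>{p. prime p \<and> p \<le> n} =
        \<Prod>{p. prime p \<and> p \<le> m + 1} * \<Prod>{p. prime p \<and> m + 1 < p \<and> p \<le> 2 * m + 1}"
      by (simp add: prod.union_disjoint disjoint_iff)
    also have "\<dots> \<le> 4 ^ (m + 1) * 4 ^ m"
      using 2 by (intro mult_mono less prod_primes_odd_le) auto
    also have "\<dots> = 4 ^ n" using 2 by (simp add: mult_2 flip: power_add)
    finally show ?thesis .
  next
    case (3 m)
    have "\<not> prime n" using 3 prime_odd_nat[of n] by auto
    hence "p \<le> n \<longleftrightarrow> p \<le> n - 1" if "prime p" for p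
      using that 3 by (cases "p = n") auto
    hence "{p. prime p \<and> p \<le> n} = {p. prime p \<and> p \<le> n - 1}" by auto
    hence "\<Prod>{p. prime p \<and> p \<le> n} \<le> 4 ^ (n - 1)"
      using less[of "n - 1"] 3 by simp
    also have "\<dots> \<le> 4 ^ n" by (intro power_increasing) auto
    finally show ?thesis .
  qed
qed

section \<open>Bertrand's postulate for large n\<close>

text \<open>At most \<open>s\<close> primes are \<open>\<le> s\<close>, and each contributes at most
  \<open>2 * n\<close>. Primes above \<open>s\<close> occur only to the first power; in the absence
  of primes between \<open>n\<close> and \<open>2 * n\<close> they are at most
  \<open>2 * n div 3\<close>, so the primorial bound applies.\<close>

lemma central_binomial_le_without_primes:
  fixes n s :: nat
  assumes "n \<ge> 3" "\<not> (\<exists>p. prime p \<and> n < p \<and> p \<le> 2 * n)"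
    and s: "2 * n < (s + 1) ^ 2"
  shows "2 * n choose n \<le> (2 * n) ^ s * 4 ^ (2 * n div 3)"
proof -
  let ?c = "2 * n choose n"
  define f where "f = (\<lambda>p. p ^ multiplicity p ?c)"
  have small: "3 * p \<le> 2 * n" if "p \<in> prime_factors ?c" for p
  proof (rule ccontr)
    assume *: "\<not> 3 * p \<le> 2 * n"
    from that have p: "prime p" "p dvd ?c" by auto
    have "fact n * fact n * ?c = (fact (2 * n) :: nat)"
      using binomial_fact_lemma[of n "2 * n"] by simp
    with p(2) have "p dvd fact (2 * n)" by (metis dvd_mult)
    hence "p \<le> 2 * n" using p(1) by (simp add: prime_dvd_fact_iff)
    hence "p \<le> n" using assms(2) p(1) by (meson not_le)
    \<comment> \<open>From \<open>3 * p > 2 * n \<ge> 6\<close> follows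
      \<open>p > 2\<close>.\<close>
    moreover have "3 \<le> p" "2 * n < 3 * p" using * assms(1) by linarith+
    ultimately have "multiplicity p ?c = 0"
      using p(1) by (intro multiplicity_central_binomial_eq_0)
    thus False using that by (simp add: prime_factors_multiplicity)
  qed
  have "?c = (\<Prod>p\<in>prime_factors ?c. f p)"
    unfolding f_def by (rule prime_factorization_nat) simp
  also have "\<dots> = (\<Prod>p\<in>prime_factors ?c \<inter> {..s}. f p) * (\<Prod>p\<in>prime_factors ?c - {..s}. f p)"
    by (subst prod.union_disjoint [symmetric]) (auto intro!: prod.cong)
  also have "\<dots> \<le> (2 * n) ^ s * 4 ^ (2 * n div 3)"
  proof (rule mult_mono)
    have "(\<Prod>p\<in>prime_factors ?c \<inter> {..s}. f p) \<le> (\<Prod>p\<in>prime_factors ?c \<inter> {..s}. 2 * n)"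
      using assms(1) unfolding f_def
      by (intro prod_mono) (auto intro!: prime_power_multiplicity_central_binomial_le)
    also have "\<dots> = (2 * n) ^ card (prime_factors ?c \<inter> {..s})" by simp
    also have "\<dots> \<le> (2 * n) ^ s"
    proof (rule power_increasing)
      have "prime_factors ?c \<inter> {..s} \<subseteq> {1..s}"
        by (auto simp: Suc_le_eq in_prime_factors_iff prime_gt_0_nat)
      from card_mono[OF _ this] show "card (prime_factors ?c \<inter> {..s}) \<le> s" by simp
    qed (use assms(1) in linarith)
    finally show "(\<Prod>p\<in>prime_factors ?c \<inter> {..s}. f p) \<le> (2 * n) ^ s" .
  next
    have "f p = p" if "p \<in> prime_factors ?c - {..s}" for p
    proof -
      have p: "prime p" "p > s" "multiplicity p ?c > 0"
        using that by (auto simp: prime_factors_multiplicity)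
      have "(s + 1) ^ 2 \<le> p ^ 2" using p by (intro power_mono) auto
      with s prime_power_multiplicity_central_binomial_le[OF p(1), of n] assms(1)
      have "p ^ multiplicity p ?c < p ^ 2" by linarith
      with prime_gt_1_nat[OF p(1)] have "multiplicity p ?c < 2"
        by (rule power_less_imp_less_exp)
      with p(3) have "multiplicity p ?c = 1" by linarith
      thus ?thesis by (simp add: f_def)
    qed
    hence "(\<Prod>p\<in>prime_factors ?c - {..s}. f p) = \<Prod>(prime_factors ?c - {..s})"
      by (intro prod.cong) auto
    also have "\<dots> \<le> \<Prod>{p. prime p \<and> p \<le> 2 * n div 3}"
    proof (rule dvd_imp_le[OF prod_dvd_prod_subset])
      show "prime_factors ?c - {..s} \<subseteq> {p. prime p \<and> p \<le> 2 * n div 3}"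
      proof
        fix p assume "p \<in> prime_factors ?c - {..s}"
        hence p: "p \<in> prime_factors ?c" by blast
        from small[OF this] have "p \<le> 2 * n div 3" by linarith
        with p show "p \<in> {p. prime p \<and> p \<le> 2 * n div 3}"
          by (simp add: in_prime_factors_iff)
      qed
    qed (auto simp: prime_gt_0_nat intro!: prod_pos)
    also have "\<dots> \<le> 4 ^ (2 * n div 3)" by (rule primorial_le)
    finally show "(\<Prod>p\<in>prime_factors ?c - {..s}. f p) \<le> 4 ^ (2 * n div 3)" .
  qed auto
  finally show ?thesis .
qed

lemma eventually_prime_between_n_and_2n:
  "eventually (\<lambda>n :: nat. \<exists>p. prime p \<and> n < p \<and> p \<le> 2 * n) at_top"
proof -
  \<comment> \<open>The factor with exponent \<open>sqrt (2 * real n)\<close> grows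
    subexponentially, so the gap between the exponents \<open>2 * n / 3\<close> and \<open>n\<close>
    of 4 decides. The right-hand side is the standard lower bound for the central binomial
    coefficient.\<close>
  have "eventually (\<lambda>n :: nat. (2 * real n) powr sqrt (2 * real n) * 4 powr (2 * real n / 3)
          < 4 powr real n / (2 * real n)) at_top"
    by real_asymp
  moreover have "eventually (\<lambda>n :: nat. n \<ge> 3) at_top" by (rule eventually_ge_at_top)
  ultimately show ?thesis
  proof eventually_elim
    case (elim n)
    show ?case
    proof (rule ccontr)
      assume *: "\<not> ?case"
      define s where "s = nat \<lfloor>sqrt (2 * real n)\<rfloor>"
      have s: "real s \<le> sqrt (2 * real n)" "sqrt (2 * real n) < real s + 1"
        unfolding s_def using real_of_int_floor_add_one_gt[of "sqrt (2 * real n)"] by auto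
      have "sqrt (2 * real n) ^ 2 < (real s + 1) ^ 2"
        using s(2) by (intro power_strict_mono) auto
      hence "real (2 * n) < real ((s + 1) ^ 2)" by (simp add: add.commute)
      hence "2 * n < (s + 1) ^ 2" by (simp only: of_nat_less_iff)
      hence "2 * n choose n \<le> (2 * n) ^ s * 4 ^ (2 * n div 3)"
        using * elim(2) by (intro central_binomial_le_without_primes)
      hence "real (2 * n choose n) \<le> real ((2 * n) ^ s * 4 ^ (2 * n div 3))"
        by (simp only: of_nat_le_iff)
      also have "\<dots> = (2 * real n) powr real s * 4 powr real (2 * n div 3)"
        using elim(2) by (simp add: powr_realpow)
      also have "\<dots> \<le> (2 * real n) powr sqrt (2 * real n) * 4 powr (2 * real n / 3)"
        using elim(2) s(1) of_nat_div_le_of_nat[of "2 * n" 3, where ?'a = real]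
        by (intro mult_mono powr_mono) auto
      also have "\<dots> < 4 powr real n / (2 * real n)" by (rule elim)
      also have "\<dots> = 4 ^ n / (2 * real n)" by (simp add: powr_realpow)
      also have "\<dots> \<le> real (2 * n choose n)"
        using elim(2) by (intro central_binomial_lower_bound) auto
      finally show False by simp
    qed
  qed
qed

lemma eventually_prime_between_half_n_and_n:
  "eventually (\<lambda>n :: nat. \<exists>p. prime p \<and> p \<le> n \<and> n < 2 * p) at_top"
proof -
  \<comment> \<open>Applied to \<open>n div 2\<close>, the postulate gives
    \<open>n div 2 < p \<le> 2 * (n div 2)\<close>, which covers both parities of
    \<open>n\<close>.\<close>
  have "filterlim (\<lambda>n :: nat. n div 2) at_top at_top"
    by (rule filterlim_at_top_div_const_nat) simp
  from eventually_compose_filterlim[OF eventually_prime_between_n_and_2n this]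
  show ?thesis by eventually_elim auto
qed

section \<open>Finiteness for d > r\<close>

text \<open>Legendre's formula is stated over \<open>nat\<close>, while the equation lives in
  \<open>int\<close>; this transfers the exponents.\<close>

lemma multiplicity_int:
  fixes p n :: nat
  assumes "prime p" "n > 0"
  shows "multiplicity (int p) (int n) = multiplicity p n"
proof (rule multiplicity_eqI)
  show "int p ^ multiplicity p n dvd int n"
    by (metis multiplicity_dvd of_nat_dvd_iff of_nat_power)
  have "\<not> p ^ Suc (multiplicity p n) dvd n"
    using assms prime_gt_1_nat[OF assms(1)] by (subst power_dvd_iff_le_multiplicity) auto
  thus "\<not> int p ^ Suc (multiplicity p n) dvd int n"
    by (metis of_nat_dvd_iff of_nat_power)
qed

text \<open>Since \<open>m < 2 * p \<le> p * p\<close>, only the first term of Legendre's formula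
  survives.\<close>

lemma multiplicity_int_fact:
  fixes p m :: nat
  assumes "prime p" "m < 2 * p"
  shows "multiplicity (int p) (fact m) = m div p"
proof -
  have "2 * p \<le> p * p" using prime_ge_2_nat[OF assms(1)] by simp
  with assms(2) have "m < p * p" by linarith
  hence "m < p ^ Suc 1" by simp
  hence "multiplicity p (fact m) = m div p"
    using multiplicity_fact_legendre[OF assms(1), of m 1] by simp
  thus ?thesis using multiplicity_int[OF assms(1), of "fact m"] by simp
qed

text \<open>Compares the exponents of \<open>p\<close> on both sides of the equation. The size
  conditions keep \<open>p\<close> from dividing \<open>b\<close> or any \<open>A i\<close>, so only
  the factorials contribute on the left.\<close>

lemma multiplicity_solution:
  fixes p :: nat
  assumes "b \<noteq> 0" "\<And>i. i \<in> {1..r} \<Longrightarrow> A i > 0" "d \<ge> 1" "(n, x) \<in> solutions b r A d"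
    and p: "prime p" "\<bar>b\<bar> < int p" "\<And>i. i \<in> {1..r} \<Longrightarrow> A i < int p"
    and n: "\<And>i. i \<in> {1..r} \<Longrightarrow> n i < 2 * p"
  shows "(\<Sum>i=1..r. n i div p) = d * multiplicity (int p) x"
proof -
  have prime: "prime_elem (int p)" using p(1) by simp
  have eq: "b * (\<Prod>i=1..r. fact (n i) * A i ^ n i) = x ^ d"
    using assms(4) by (simp add: solutions_def)
  have A: "A i \<noteq> 0" if "i \<in> {1..r}" for i using assms(2)[OF that] by simp
  have nz: "(\<Prod>i=1..r. fact (n i) * A i ^ n i) \<noteq> 0" using A by simp
  with eq assms(1,3) have "x \<noteq> 0" by (auto simp: power_0_left)
  have factor: "multiplicity (int p) (fact (n i) * A i ^ n i) = n i div p" if "i \<in> {1..r}" for i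
  proof -
    have "\<not> int p dvd A i" using assms(2) p(3) that by (meson zdvd_not_zless)
    thus ?thesis
      using prime A[OF that] multiplicity_int_fact[OF p(1) n[OF that]]
      by (simp add: prime_elem_multiplicity_mult_distrib prime_elem_multiplicity_power_distrib
          not_dvd_imp_multiplicity_0)
  qed
  have "(\<Sum>i=1..r. n i div p) = (\<Sum>i=1..r. multiplicity (int p) (fact (n i) * A i ^ n i))"
    using factor by (intro sum.cong) auto
  also have "\<dots> = multiplicity (int p) (\<Prod>i=1..r. fact (n i) * A i ^ n i)"
    using prime A by (intro prime_elem_multiplicity_prod_distrib [symmetric]) auto
  also have "\<not> int p dvd b"
    using assms(1) p(2) zdvd_not_zless[of "\<bar>b\<bar>" "int p"] by simp
  hence "multiplicity (int p) (\<Prod>i=1..r. fact (n i) * A i ^ n i) =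
      multiplicity (int p) b + multiplicity (int p) (\<Prod>i=1..r. fact (n i) * A i ^ n i)"
    by (simp add: not_dvd_imp_multiplicity_0)
  also have "\<dots> = multiplicity (int p) (x ^ d)"
    using prime nz assms(1) by (simp add: prime_elem_multiplicity_mult_distrib flip: eq)
  also have "\<dots> = d * multiplicity (int p) x"
    using prime \<open>x \<noteq> 0\<close> by (simp add: prime_elem_multiplicity_power_distrib)
  finally show ?thesis .
qed

lemma solutions_bounded:
  assumes "b \<noteq> 0" "\<And>i. i \<in> {1..r} \<Longrightarrow> A i > 0" "d > r"
  obtains M where "\<And>n x i. (n, x) \<in> solutions b r A d \<Longrightarrow> i \<in> {1..r} \<Longrightarrow> n i \<le> M"
proof -
  from eventually_prime_between_half_n_and_n obtain N where
    N: "\<And>n :: nat. n \<ge> N \<Longrightarrow> \<exists>p. prime p \<and> p \<le> n \<and> n < 2 * p"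
    by (auto simp: eventually_at_top_linorder)
  define B where "B = \<bar>b\<bar> + (\<Sum>i=1..r. A i)"
  \<comment> \<open>For a maximum \<open>m > M\<close>, the part \<open>N\<close> supplies a prime
    \<open>p\<close> with \<open>p \<le> m < 2 * p\<close>, and \<open>2 * nat B\<close> then forces
    \<open>p > B\<close>.\<close>
  define M where "M = max N (2 * nat B)"
  have A_le: "A i \<le> (\<Sum>i=1..r. A i)" if "i \<in> {1..r}" for i
    using assms(2) that by (intro member_le_sum) (auto intro: less_imp_le)
  have "n i \<le> M" if sol: "(n, x) \<in> solutions b r A d" and i: "i \<in> {1..r}" for n x i
  proof (rule ccontr)
    assume "\<not> n i \<le> M"
    define m where "m = Max (n ` {1..r})"
    have m_ge: "n k \<le> m" if "k \<in> {1..r}" for k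
      unfolding m_def using that by (intro Max_ge) auto
    have "m \<in> n ` {1..r}" unfolding m_def using i by (intro Max_in) auto
    then obtain j where j: "j \<in> {1..r}" "n j = m" by auto
    have "m > M" using m_ge[OF i] \<open>\<not> n i \<le> M\<close> by simp
    with N[of m] obtain p where p: "prime p" "p \<le> m" "m < 2 * p" by (auto simp: M_def)
    have B: "B < int p" using p(3) \<open>m > M\<close> by (auto simp: M_def)
    have "(\<Sum>k=1..r. A k) \<ge> 0" using A_le[OF i] assms(2)[OF i] by simp
    hence "\<bar>b\<bar> < int p" using B by (simp add: B_def)
    moreover have "A k < int p" if "k \<in> {1..r}" for k
      using A_le[OF that] B by (simp add: B_def)
    moreover have small: "n k < 2 * p" if "k \<in> {1..r}" for k
      using m_ge[OF that] p(3) by simp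
    ultimately have eq: "(\<Sum>k=1..r. n k div p) = d * multiplicity (int p) x"
      using assms sol p(1) by (intro multiplicity_solution[of b r A d n x p]) auto
    have "n k div p \<le> 1" if "k \<in> {1..r}" for k
      using small[OF that] by (simp add: less_mult_imp_div_less flip: less_Suc_eq_le)
    hence "(\<Sum>k=1..r. n k div p) \<le> (\<Sum>k=1..r. 1)" by (intro sum_mono)
    \<comment> \<open>The sum is a multiple of \<open>d\<close> but at most \<open>r < d\<close>,
      hence 0, although the index \<open>j\<close> of the maximum contributes a positive
      term.\<close>
    with eq assms(3) have "multiplicity (int p) x = 0"
      by (cases "multiplicity (int p) x") auto
    with eq have "\<forall>k\<in>{1..r}. n k div p = 0" by simp
    with j have "m div p = 0" by metis
    with p show False by (simp add: div_eq_0_iff prime_gt_0_nat)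
  qed
  thus thesis by (rule that)
qed

lemma finite_int_roots:
  fixes c :: int
  assumes "d \<ge> 1"
  shows "finite {x. x ^ d = c}"
proof (rule finite_subset)
  show "{x. x ^ d = c} \<subseteq> {- \<bar>c\<bar>..\<bar>c\<bar>}"
  proof
    fix x assume "x \<in> {x. x ^ d = c}"
    hence c: "\<bar>c\<bar> = \<bar>x\<bar> ^ d" by (auto simp: power_abs)
    have "\<bar>x\<bar> \<le> \<bar>x\<bar> ^ d"
      using assms by (cases "x = 0") (auto intro!: self_le_power)
    thus "x \<in> {- \<bar>c\<bar>..\<bar>c\<bar>}" unfolding c[symmetric] by auto
  qed
qed simp

lemma finite_solutions:
  assumes "b \<noteq> 0" "\<And>i. i \<in> {1..r} \<Longrightarrow> A i > 0" "d > r"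
  shows "finite (solutions b r A d)"
proof -
  obtain M where M: "\<And>n x i. (n, x) \<in> solutions b r A d \<Longrightarrow> i \<in> {1..r} \<Longrightarrow> n i \<le> M"
    by (rule solutions_bounded[of b r A d]) (use assms in auto)
  have "solutions b r A d \<subseteq> (SIGMA n : {1..r} \<rightarrow>\<^sub>E {..M}.
          {x. x ^ d = b * (\<Prod>i=1..r. fact (n i) * A i ^ n i)})"
  proof (rule subrelI)
    fix n x assume sol: "(n, x) \<in> solutions b r A d"
    have "n \<in> {1..r} \<rightarrow>\<^sub>E {..M}"
      using sol M[OF sol] by (auto simp: solutions_def PiE_iff)
    with sol show "(n, x) \<in> (SIGMA n : {1..r} \<rightarrow>\<^sub>E {..M}.
          {x. x ^ d = b * (\<Prod>i=1..r. fact (n i) * A i ^ n i)})"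
      by (simp add: solutions_def)
  qed
  moreover have "finite \<dots>"
    using assms(3) by (intro finite_SigmaI finite_PiE finite_int_roots) auto
  ultimately show ?thesis by (rule finite_subset)
qed

section \<open>Infinite families of solutions for d at most r\<close>

lemma infinite_solutions:
  fixes b :: int
  assumes "b \<noteq> 0" and A: "\<And>i. i \<in> {1..r} \<Longrightarrow> A i > 0" and d: "1 \<le> d" "d \<le> r"
    and sgn: "b > 0 \<or> odd d"
  shows "infinite (solutions b r A d)"
proof -
  define C where "C = (\<Prod>i=2..d. A i)"
  have C: "C > 0" unfolding C_def using A d by (intro prod_pos) auto
  \<comment> \<open>The constant in front makes \<open>b * N m\<close> equal to \<open>C\<close>
    times a \<open>d\<close>-th power. The factor \<open>d\<close> inside the power makes
    \<open>d\<close> divide \<open>N m\<close>, so that \<open>A 1 ^ N m\<close> and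
    \<open>C ^ N m\<close> are \<open>d\<close>-th powers as well.\<close>
  define N where "N = (\<lambda>m. nat (C * \<bar>b\<bar> ^ (d - 1)) * (d * Suc m) ^ d)"
  define n where "n = (\<lambda>m. \<lambda>i\<in>{1..r}. if i = 1 then N m else if i \<le> d then N m - 1 else 0)"
  define x where "x = (\<lambda>m. fact (N m - 1) * (A 1 * C) ^ (N m div d) * b * int (d * Suc m))"
  have "(n m, x m) \<in> solutions b r A d" for m
  proof -
    \<comment> \<open>The sign hypothesis enters here: for negative \<open>b\<close> the exponent
      \<open>d - 1\<close> must be even.\<close>
    have "b * \<bar>b\<bar> ^ (d - 1) = b ^ d"
    proof (cases "b > 0")
      case False
      with sgn have "even (d - 1)" "d > 0" using d by auto
      thus ?thesis by (simp add: power_even_abs flip: power_Suc)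
    qed (use d in \<open>simp flip: power_Suc\<close>)
    hence b_pow: "b * \<bar>b\<bar> ^ (d - 1) * int (d * Suc m) ^ d = (b * int (d * Suc m)) ^ d"
      by (simp only: power_mult_distrib)
    have "int (N m) = C * \<bar>b\<bar> ^ (d - 1) * int (d * Suc m) ^ d"
      using C by (simp add: N_def)
    hence bN: "b * int (N m) = C * (b * int (d * Suc m)) ^ d"
      by (simp only: mult_ac flip: b_pow)
    have "N m > 0" using C assms(1) d by (auto simp: N_def)
    hence N_Suc: "N m = Suc (N m - 1)" by simp
    have "d dvd (d * Suc m) ^ d"
      using d by (intro dvd_trans[OF dvd_triv_left dvd_power]) simp
    hence "d dvd N m" unfolding N_def by (rule dvd_mult)
    hence N_div: "N m div d * d = N m" by simp
    have split: "{1..r} = insert 1 {2..d} \<union> {d<..r}" using d by auto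
    have "(\<Prod>i=1..r. fact (n m i) * A i ^ n m i) =
        (\<Prod>i\<in>insert 1 {2..d}. fact (n m i) * A i ^ n m i) * (\<Prod>i\<in>{d<..r}. fact (n m i) * A i ^ n m i)"
      unfolding split by (rule prod.union_disjoint) (use d in auto)
    also have "(\<Prod>i\<in>{d<..r}. fact (n m i) * A i ^ n m i) = 1"
      using d by (intro prod.neutral) (auto simp: n_def)
    also have "(\<Prod>i\<in>insert 1 {2..d}. fact (n m i) * A i ^ n m i) =
        fact (N m) * A 1 ^ N m * (\<Prod>i=2..d. fact (n m i) * A i ^ n m i)"
      using d by (simp add: n_def)
    also have "(\<Prod>i=2..d. fact (n m i) * A i ^ n m i) = (\<Prod>i=2..d. fact (N m - 1) * A i ^ (N m - 1))"
      using d by (intro prod.cong) (auto simp: n_def)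
    also have "\<dots> = fact (N m - 1) ^ (d - 1) * C ^ (N m - 1)"
      by (simp add: prod.distrib C_def prod_power_distrib)
    \<comment> \<open>Splitting off \<open>N m\<close> leaves \<open>d\<close> equal factorials,
      whose product is a \<open>d\<close>-th power.\<close>
    also have "fact (N m) = int (N m) * fact (N m - 1)"
      by (subst (1 2) N_Suc) (simp only: fact_Suc diff_Suc_1)
    finally have "b * (\<Prod>i=1..r. fact (n m i) * A i ^ n m i) =
        (b * int (N m)) * C ^ (N m - 1) * A 1 ^ N m * (fact (N m - 1) * fact (N m - 1) ^ (d - 1))"
      by (simp only: mult_ac mult_1_right)
    \<comment> \<open>The factor \<open>C\<close> released by \<open>b * N m\<close> completes
      \<open>C ^ (N m - 1)\<close> to \<open>C ^ N m\<close>.\<close>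
    also have "\<dots> = (b * int (d * Suc m)) ^ d * (C * C ^ (N m - 1)) * A 1 ^ N m * (fact (N m - 1) * fact (N m - 1) ^ (d - 1))"
      unfolding bN by (simp only: mult_ac)
    also have "C * C ^ (N m - 1) = C ^ N m"
      using \<open>N m > 0\<close> by (simp flip: power_Suc)
    also have "fact (N m - 1) * fact (N m - 1) ^ (d - 1) = (fact (N m - 1) :: int) ^ d"
      using d by (simp flip: power_Suc)
    also have "(b * int (d * Suc m)) ^ d * C ^ N m * A 1 ^ N m * fact (N m - 1) ^ d = x m ^ d"
      unfolding x_def power_mult_distrib power_mult[symmetric] N_div by (simp only: mult_ac)
    finally show ?thesis by (auto simp: solutions_def n_def)
  qed
  moreover have "inj (\<lambda>m. (n m, x m))"
  proof (rule injI)
    fix k m assume "(n k, x k) = (n m, x m)"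
    \<comment> \<open>The first unknown is \<open>N m\<close> itself, which determines
      \<open>m\<close> once the positive constant is cancelled.\<close>
    hence "n k 1 = n m 1" by simp
    hence "N k = N m" using d by (simp add: n_def)
    moreover have "C * \<bar>b\<bar> ^ (d - 1) > 0" using C assms(1) by simp
    ultimately have "(d * Suc k) ^ d = (d * Suc m) ^ d" by (simp add: N_def)
    hence "d * Suc k = d * Suc m" by (rule power_eq_imp_eq_base) (use d in auto)
    thus "k = m" using d by simp
  qed
  ultimately show ?thesis
    unfolding infinite_iff_countable_subset by (intro exI[of _ "\<lambda>m. (n m, x m)"]) auto
qed

theorem theorem1p1:
  fixes b :: int and r d :: nat and A :: "nat \<Rightarrow> int"
  assumes "b \<noteq> 0" and "r \<ge> 1" and "\<And>i. i \<in> {1..r} \<Longrightarrow> A i > 0" and "d \<ge> 1"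
  shows "(d > r \<longrightarrow> finite (solutions b r A d)) \<and>
         (d \<le> r \<longrightarrow> (if b < 0 \<and> even d then solutions b r A d = {}
                     else infinite (solutions b r A d)))"
proof -
  have "solutions b r A d = {}" if "b < 0" "even d"
  proof -
    have False if "(n, x) \<in> solutions b r A d" for n x
    proof -
      have "(\<Prod>i=1..r. fact (n i) * A i ^ n i) > 0"
        using assms(3) by (intro prod_pos) auto
      with \<open>b < 0\<close> have "b * (\<Prod>i=1..r. fact (n i) * A i ^ n i) < 0" by (rule mult_neg_pos)
      moreover have "x ^ d \<ge> 0" using \<open>even d\<close> by (rule zero_le_even_power)
      ultimately show False using that by (simp add: solutions_def)
    qed
    thus ?thesis by auto
  qed
  moreover have "infinite (solutions b r A d)" if "d \<le> r" "\<not> (b < 0 \<and> even d)"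
    using assms that by (intro infinite_solutions) auto
  ultimately show ?thesis using finite_solutions[OF assms(1,3)] by auto
qed
end
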